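(* Let $G$ be a connected Lie group with Lie algebra $\mathfrak{g}$, equipped with a left-invariant Riemannian metric $g=\langle\cdot,\cdot\rangle$, and let $U:\mathfrak{g}\times\mathfrak{g}\to\mathfrak{g}$ be the symmetric bilinear map defined by $$2\langle U(X,Y),Z\rangle=\langle[Z,X],Y\rangle+\langle X,[Z,Y]\rangle,\qquad X,Y,Z\in\mathfrak{g}.$$ Then every left-invariant connection $\nabla$ on $G$ compatible with $g$ is represented as $$\nabla_XY=\nu(X,Y)+\frac12[X,Y],\qquad X,Y\in\mathfrak{g},$$ for some symmetric bilinear map $\nu:\mathfrak{g}\times\mathfrak{g}\to\mathfrak{g}$ satisfying $$\langle U(Y,Z)-\nu(Y,Z),X\rangle=\langle Y,U(X,Z)-\nu(X,Z)\rangle$$ for all $X,Y,Z\in\mathfrak{g}$.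
   Context: Elements of $\mathfrak{g}$ are regarded as left-invariant vector fields on $G$. An affine connection on $G$ is left-invariant if it is invariant under left translations. A connection $\nabla$ is compatible with $g$ if it is torsion-free and $\nabla g$ is totally symmetric, i.e. $(\nabla_Xg)(Y,Z)$ is symmetric in $X,Y,Z$. *)

theory Defs
  imports "HOL-Analysis.Analysis" "HOL-Library.Function_Algebras"
begin

text \<open>The set \<open>S\<close> is meant to be open: derivatives are taken in the full space.  On a
  finite-dimensional space, continuity of all iterated directional derivatives is the usual
  notion of being \<open>k\<close> times continuously differentiable.\<close>

primrec C_k_on :: "nat \<Rightarrow> 'e set \<Rightarrow> ('e::real_normed_vector \<Rightarrow> 'f::real_normed_vector) \<Rightarrow> bool" where
  "C_k_on 0 S f \<longleftrightarrow> continuous_on S f"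
| "C_k_on (Suc k) S f \<longleftrightarrow>
     (\<forall>x\<in>S. f differentiable (at x)) \<and> (\<forall>v. C_k_on k S (\<lambda>x. frechet_derivative f (at x) v))"

definition smooth_on :: "'e set \<Rightarrow> ('e::real_normed_vector \<Rightarrow> 'f::real_normed_vector) \<Rightarrow> bool" where
  "smooth_on S f \<longleftrightarrow> (\<forall>k. C_k_on k S f)"

text \<open>A manifold is a type whose topology is Hausdorff and second countable, with a smooth atlas.
  A chart is a pair of an open domain and a coordinate map, whose values outside the domain are
  irrelevant.  The model space is a finite-dimensional real normed space, not a
  \<open>euclidean_space\<close>, because the latter class excludes dimension zero.\<close>

type_synonym ('a, 'e) atlas = "('a set \<times> ('a \<Rightarrow> 'e)) set"

definition smooth_atlas ::
  "('a::{t2_space,second_countable_topology}, 'e::real_normed_vector) atlas \<Rightarrow> bool" where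
  "smooth_atlas A \<longleftrightarrow>
     (\<exists>B::'e set. finite B \<and> span B = UNIV) \<and>
     (\<Union>(U, \<phi>)\<in>A. U) = UNIV \<and>
     (\<forall>(U, \<phi>)\<in>A. open U \<and> open (\<phi> ` U) \<and> (\<exists>\<psi>. homeomorphism U (\<phi> ` U) \<phi> \<psi>)) \<and>
     (\<forall>(U, \<phi>)\<in>A. \<forall>(V, \<psi>)\<in>A. smooth_on (\<phi> ` (U \<inter> V)) (\<psi> \<circ> inv_into U \<phi>))"

definition product_atlas ::
  "('a, 'e) atlas \<Rightarrow> ('b, 'f) atlas \<Rightarrow> ('a \<times> 'b, 'e \<times> 'f) atlas" where
  "product_atlas A B = {(U \<times> V, map_prod \<phi> \<psi>) | U \<phi> V \<psi>. (U, \<phi>) \<in> A \<and> (V, \<psi>) \<in> B}"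

definition smooth_map ::
  "('a::topological_space, 'e::real_normed_vector) atlas \<Rightarrow>
   ('b::topological_space, 'f::real_normed_vector) atlas \<Rightarrow> ('a \<Rightarrow> 'b) \<Rightarrow> bool" where
  "smooth_map A B F \<longleftrightarrow> continuous_on UNIV F \<and>
     (\<forall>(U, \<phi>)\<in>A. \<forall>(V, \<psi>)\<in>B. smooth_on (\<phi> ` (U \<inter> F -` V)) (\<psi> \<circ> F \<circ> inv_into U \<phi>))"

definition smooth_fun ::
  "('a::topological_space, 'e::real_normed_vector) atlas \<Rightarrow> ('a \<Rightarrow> real) \<Rightarrow> bool" where
  "smooth_fun A f \<longleftrightarrow> smooth_map A {(UNIV, id)} f"

text \<open>A tangent vector at \<open>p\<close> is a derivation at \<open>p\<close> of the algebra of smooth functions.  It is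
  extended by zero to the functions that are not smooth, so that equal derivations are equal as
  HOL functions.  Sums and products are the pointwise ones of \<open>HOL-Library.Function_Algebras\<close>.\<close>

type_synonym 'a tvec = "('a \<Rightarrow> real) \<Rightarrow> real"
type_synonym 'a vfield = "'a \<Rightarrow> 'a tvec"

definition tangent_space ::
  "('a::topological_space, 'e::real_normed_vector) atlas \<Rightarrow> 'a \<Rightarrow> 'a tvec set" where
  "tangent_space A p = {v.
     (\<forall>f h. smooth_fun A f \<longrightarrow> smooth_fun A h \<longrightarrow> v (f + h) = v f + v h) \<and>
     (\<forall>c f. smooth_fun A f \<longrightarrow> v (\<lambda>q. c * f q) = c * v f) \<and>
     (\<forall>f h. smooth_fun A f \<longrightarrow> smooth_fun A h \<longrightarrow> v (f * h) = v f * h p + f p * v h) \<and>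
     (\<forall>f. \<not> smooth_fun A f \<longrightarrow> v f = 0)}"

definition tscale :: "real \<Rightarrow> 'a tvec \<Rightarrow> 'a tvec" where
  "tscale c v = (\<lambda>f. c * v f)"

definition app :: "'a vfield \<Rightarrow> ('a \<Rightarrow> real) \<Rightarrow> 'a \<Rightarrow> real" where
  "app X f = (\<lambda>p. X p f)"

definition vector_fields ::
  "('a::topological_space, 'e::real_normed_vector) atlas \<Rightarrow> 'a vfield set" where
  "vector_fields A = {X. (\<forall>p. X p \<in> tangent_space A p) \<and>
     (\<forall>f. smooth_fun A f \<longrightarrow> smooth_fun A (app X f))}"

definition vscale :: "('a \<Rightarrow> real) \<Rightarrow> 'a vfield \<Rightarrow> 'a vfield" where
  "vscale h X = (\<lambda>p. tscale (h p) (X p))"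

definition lie_bracket :: "'a vfield \<Rightarrow> 'a vfield \<Rightarrow> 'a vfield" where
  "lie_bracket X Y = (\<lambda>p f. X p (app Y f) - Y p (app X f))"

text \<open>\<open>tangent_map A F\<close> is the differential of the self-map \<open>F\<close>; the guard keeps the extension by zero.\<close>

definition tangent_map ::
  "('a::topological_space, 'e::real_normed_vector) atlas \<Rightarrow> ('a \<Rightarrow> 'a) \<Rightarrow> 'a tvec \<Rightarrow> 'a tvec" where
  "tangent_map A F v = (\<lambda>f. if smooth_fun A f then v (f \<circ> F) else 0)"

type_synonym 'a metric_tensor = "'a \<Rightarrow> 'a tvec \<Rightarrow> 'a tvec \<Rightarrow> real"
type_synonym 'a connection = "'a vfield \<Rightarrow> 'a vfield \<Rightarrow> 'a vfield"

text \<open>Smoothness of the metric: it maps smooth vector fields to smooth functions.  Linearity in the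
  second argument follows from symmetry.  Values off the tangent spaces are irrelevant.\<close>

definition riemannian_metric ::
  "('a::topological_space, 'e::real_normed_vector) atlas \<Rightarrow> 'a metric_tensor \<Rightarrow> bool" where
  "riemannian_metric A g \<longleftrightarrow>
     (\<forall>p. \<forall>u\<in>tangent_space A p. \<forall>v\<in>tangent_space A p. \<forall>w\<in>tangent_space A p. \<forall>c.
        g p (u + v) w = g p u w + g p v w \<and> g p (tscale c u) w = c * g p u w) \<and>
     (\<forall>p. \<forall>v\<in>tangent_space A p. \<forall>w\<in>tangent_space A p. g p v w = g p w v) \<and>
     (\<forall>p. \<forall>v\<in>tangent_space A p. v \<noteq> 0 \<longrightarrow> 0 < g p v v) \<and>
     (\<forall>X\<in>vector_fields A. \<forall>Y\<in>vector_fields A. smooth_fun A (\<lambda>p. g p (X p) (Y p)))"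

definition affine_connection ::
  "('a::topological_space, 'e::real_normed_vector) atlas \<Rightarrow> 'a connection \<Rightarrow> bool" where
  "affine_connection A D \<longleftrightarrow>
     (\<forall>X\<in>vector_fields A. \<forall>Y\<in>vector_fields A. D X Y \<in> vector_fields A) \<and>
     (\<forall>X\<in>vector_fields A. \<forall>X'\<in>vector_fields A. \<forall>Y\<in>vector_fields A.
        D (X + X') Y = D X Y + D X' Y) \<and>
     (\<forall>h. \<forall>X\<in>vector_fields A. \<forall>Y\<in>vector_fields A.
        smooth_fun A h \<longrightarrow> D (vscale h X) Y = vscale h (D X Y)) \<and>
     (\<forall>X\<in>vector_fields A. \<forall>Y\<in>vector_fields A. \<forall>Y'\<in>vector_fields A.
        D X (Y + Y') = D X Y + D X Y') \<and>
     (\<forall>h. \<forall>X\<in>vector_fields A. \<forall>Y\<in>vector_fields A.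
        smooth_fun A h \<longrightarrow> D X (vscale h Y) = vscale (app X h) Y + vscale h (D X Y))"

definition torsion_free ::
  "('a::topological_space, 'e::real_normed_vector) atlas \<Rightarrow> 'a connection \<Rightarrow> bool" where
  "torsion_free A D \<longleftrightarrow>
     (\<forall>X\<in>vector_fields A. \<forall>Y\<in>vector_fields A. D X Y - D Y X = lie_bracket X Y)"

text \<open>\<open>cov_deriv_metric D g X Y Z\<close> is the function \<open>(\<nabla>\<^sub>X g)(Y, Z)\<close>.\<close>

definition cov_deriv_metric ::
  "'a connection \<Rightarrow> 'a metric_tensor \<Rightarrow> 'a vfield \<Rightarrow> 'a vfield \<Rightarrow> 'a vfield \<Rightarrow> 'a \<Rightarrow> real" where
  "cov_deriv_metric D g X Y Z = (\<lambda>p.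
     X p (\<lambda>q. g q (Y q) (Z q)) - g p (D X Y p) (Z p) - g p (Y p) (D X Z p))"

text \<open>The two transpositions below generate all permutations of the three arguments.\<close>

definition compatible ::
  "('a::topological_space, 'e::real_normed_vector) atlas \<Rightarrow> 'a metric_tensor \<Rightarrow> 'a connection \<Rightarrow> bool"
  where
  "compatible A g D \<longleftrightarrow> torsion_free A D \<and>
     (\<forall>X\<in>vector_fields A. \<forall>Y\<in>vector_fields A. \<forall>Z\<in>vector_fields A.
        cov_deriv_metric D g X Y Z = cov_deriv_metric D g Y X Z \<and>
        cov_deriv_metric D g X Y Z = cov_deriv_metric D g X Z Y)"

definition lie_group ::
  "('a \<Rightarrow> 'a \<Rightarrow> 'a) \<Rightarrow> 'a \<Rightarrow> ('a \<Rightarrow> 'a) \<Rightarrow>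
   ('a::{t2_space,second_countable_topology}, 'e::real_normed_vector) atlas \<Rightarrow> bool" where
  "lie_group mul e minv A \<longleftrightarrow> group mul e minv \<and> smooth_atlas A \<and>
     smooth_map (product_atlas A A) A (\<lambda>(a, b). mul a b) \<and> smooth_map A A minv"

definition left_invariant_metric ::
  "('a \<Rightarrow> 'a \<Rightarrow> 'a) \<Rightarrow> ('a::topological_space, 'e::real_normed_vector) atlas \<Rightarrow>
   'a metric_tensor \<Rightarrow> bool" where
  "left_invariant_metric mul A g \<longleftrightarrow>
     (\<forall>a p. \<forall>v\<in>tangent_space A p. \<forall>w\<in>tangent_space A p.
        g (mul a p) (tangent_map A (mul a) v) (tangent_map A (mul a) w) = g p v w)"

text \<open>The push-forward of a vector field by the left translation \<open>p \<mapsto> a p\<close>.\<close>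

definition left_translate ::
  "('a \<Rightarrow> 'a \<Rightarrow> 'a) \<Rightarrow> ('a \<Rightarrow> 'a) \<Rightarrow> ('a::topological_space, 'e::real_normed_vector) atlas \<Rightarrow>
   'a \<Rightarrow> 'a vfield \<Rightarrow> 'a vfield" where
  "left_translate mul minv A a X = (\<lambda>p. tangent_map A (mul a) (X (mul (minv a) p)))"

definition left_invariant_connection ::
  "('a \<Rightarrow> 'a \<Rightarrow> 'a) \<Rightarrow> ('a \<Rightarrow> 'a) \<Rightarrow> ('a::topological_space, 'e::real_normed_vector) atlas \<Rightarrow>
   'a connection \<Rightarrow> bool" where
  "left_invariant_connection mul minv A D \<longleftrightarrow>
     (\<forall>a. \<forall>X\<in>vector_fields A. \<forall>Y\<in>vector_fields A.
        left_translate mul minv A a (D X Y) =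
        D (left_translate mul minv A a X) (left_translate mul minv A a Y))"

definition lie_algebra ::
  "('a \<Rightarrow> 'a \<Rightarrow> 'a) \<Rightarrow> ('a \<Rightarrow> 'a) \<Rightarrow> ('a::topological_space, 'e::real_normed_vector) atlas \<Rightarrow>
   'a vfield set" where
  "lie_algebra mul minv A = {X \<in> vector_fields A. \<forall>a. left_translate mul minv A a X = X}"

text \<open>On left-invariant fields, \<open>g\<close> is constant if it is left-invariant; the inner product on the
  Lie algebra is its value at the identity \<open>e\<close>.\<close>

definition lie_inner :: "'a \<Rightarrow> 'a metric_tensor \<Rightarrow> 'a vfield \<Rightarrow> 'a vfield \<Rightarrow> real" where
  "lie_inner e g X Y = g e (X e) (Y e)"

text \<open>Linearity in the second argument follows from symmetry.\<close>

definition symmetric_bilinear_map ::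
  "'a vfield set \<Rightarrow> ('a vfield \<Rightarrow> 'a vfield \<Rightarrow> 'a vfield) \<Rightarrow> bool" where
  "symmetric_bilinear_map L B \<longleftrightarrow>
     (\<forall>X\<in>L. \<forall>Y\<in>L. B X Y \<in> L \<and> B X Y = B Y X) \<and>
     (\<forall>X\<in>L. \<forall>X'\<in>L. \<forall>Y\<in>L. B (X + X') Y = B X Y + B X' Y) \<and>
     (\<forall>c. \<forall>X\<in>L. \<forall>Y\<in>L. B (vscale (\<lambda>_. c) X) Y = vscale (\<lambda>_. c) (B X Y))"

end

theory Submission
  imports Defs
begin

text \<open>Take \<open>\<nu>(X, Y) = \<nabla>\<^sub>XY - 1/2 [X, Y]\<close>: it is symmetric because \<open>\<nabla>\<close> is torsion-free, and it takes
  values in the Lie algebra because \<open>\<nabla>\<close> is left-invariant.  Inner products of left-invariant fields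
  are constant, so \<open>(\<nabla>\<^sub>Xg)(Y, Z) = -\<langle>\<nabla>\<^sub>XY, Z\<rangle> - \<langle>Y, \<nabla>\<^sub>XZ\<rangle>\<close>; exchanging \<open>X\<close> and \<open>Y\<close> gives the
  identity relating \<open>U\<close> and \<open>\<nu>\<close>.\<close>

section \<open>Algebra of smooth functions\<close>

text \<open>Openness of \<open>S\<close> is what makes agreement on \<open>S\<close> sufficient: a
  derivative at a point of \<open>S\<close> depends only on values near that point, so the
  directional derivatives agree on \<open>S\<close> too, and the induction passes to them.\<close>

lemma C_k_on_cong:
  assumes "open S" "\<And>x. x \<in> S \<Longrightarrow> f x = h x" "C_k_on k S f"
  shows "C_k_on k S h"
  using assms(2,3)
proof (induction k arbitrary: f h)
  case 0
  then show ?case by (simp cong: continuous_on_cong)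
next
  case (Suc k)
  have D: "(h has_derivative frechet_derivative f (at x)) (at x)" if "x \<in> S" for x
  proof (rule has_derivative_transform_within_open[OF _ assms(1) that])
    show "(f has_derivative frechet_derivative f (at x)) (at x)"
      using Suc.prems(2) that by (simp add: frechet_derivative_works)
  qed (use Suc.prems(1) in auto)
  have "frechet_derivative h (at x) = frechet_derivative f (at x)" if "x \<in> S" for x
    using frechet_derivative_at[OF D[OF that]] by simp
  then have "C_k_on k S (\<lambda>x. frechet_derivative h (at x) v)" for v
    using Suc.prems(2)
    by - (rule Suc.IH[of "\<lambda>x. frechet_derivative f (at x) v"], simp_all)
  moreover have "h differentiable (at x)" if "x \<in> S" for x
    using D[OF that] by (rule differentiableI)
  ultimately show ?case by simp
qed

text \<open>By uniqueness of derivatives, an explicit formula \<open>f'\<close> can stand in for the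
  chosen \<open>frechet_derivative\<close>, but only on \<open>S\<close>; hence the appeal to the
  congruence lemma.\<close>

lemma C_k_on_SucI:
  assumes "open S" "\<And>x. x \<in> S \<Longrightarrow> (f has_derivative f' x) (at x)"
    and "\<And>v. C_k_on k S (\<lambda>x. f' x v)"
  shows "C_k_on (Suc k) S f"
proof -
  have "f' x v = frechet_derivative f (at x) v" if "x \<in> S" for x v
    using frechet_derivative_at[OF assms(2)[OF that]] by simp
  then have "C_k_on k S (\<lambda>x. frechet_derivative f (at x) v)" for v
    by (rule C_k_on_cong[OF assms(1) _ assms(3)])
  then show ?thesis
    using differentiableI[OF assms(2)] by simp
qed

lemma C_k_on_Suc_has_derivative:
  assumes "C_k_on (Suc k) S f" "x \<in> S"
  shows "(f has_derivative frechet_derivative f (at x)) (at x)"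
  using assms by (simp add: frechet_derivative_works)

lemma C_k_on_SucD: "C_k_on (Suc k) S f \<Longrightarrow> C_k_on k S f"
proof (induction k arbitrary: f)
  case 0
  then show ?case
    by (simp add: continuous_at_imp_continuous_on differentiable_imp_continuous_within)
next
  case (Suc k)
  have "C_k_on k S (\<lambda>x. frechet_derivative f (at x) v)" for v
    using Suc.prems by (intro Suc.IH) simp
  then show ?case using Suc.prems by simp
qed

lemma C_k_on_const: "C_k_on k S (\<lambda>_. c)"
  by (induction k arbitrary: c) simp_all

lemma C_k_on_add:
  assumes "open S" "C_k_on k S f" "C_k_on k S h"
  shows "C_k_on k S (\<lambda>x. f x + h x)"
  using assms(2,3)
proof (induction k arbitrary: f h)
  case 0
  then show ?case by (simp add: continuous_on_add)
next
  case (Suc k)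
  show ?case
  proof (rule C_k_on_SucI[OF assms(1)])
    fix x assume "x \<in> S"
    then show "((\<lambda>x. f x + h x) has_derivative
        (\<lambda>v. frechet_derivative f (at x) v + frechet_derivative h (at x) v)) (at x)"
      using Suc.prems by (intro has_derivative_add C_k_on_Suc_has_derivative)
  next
    fix v
    show "C_k_on k S (\<lambda>x. frechet_derivative f (at x) v + frechet_derivative h (at x) v)"
      using Suc.prems by (intro Suc.IH) simp_all
  qed
qed

lemma C_k_on_mult:
  fixes f h :: "_ \<Rightarrow> 'b::real_normed_algebra"
  assumes "open S" "C_k_on k S f" "C_k_on k S h"
  shows "C_k_on k S (\<lambda>x. f x * h x)"
  using assms(2,3)
proof (induction k arbitrary: f h)
  case 0
  then show ?case by (simp add: continuous_on_mult)
next
  case (Suc k)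
  show ?case
  proof (rule C_k_on_SucI[OF assms(1)])
    fix x assume "x \<in> S"
    then show "((\<lambda>x. f x * h x) has_derivative
        (\<lambda>v. f x * frechet_derivative h (at x) v + frechet_derivative f (at x) v * h x)) (at x)"
      using Suc.prems by (intro has_derivative_mult C_k_on_Suc_has_derivative)
  next
    fix v
    \<comment> \<open>The Leibniz formula pairs each derivative with an undifferentiated factor, so
      the induction hypothesis also asks for the factors at level \<open>k\<close>.\<close>
    have "C_k_on k S f" "C_k_on k S h"
      using Suc.prems by (simp_all add: C_k_on_SucD)
    then show "C_k_on k S (\<lambda>x. f x * frechet_derivative h (at x) v + frechet_derivative f (at x) v * h x)"
      using Suc.prems by (intro C_k_on_add assms(1) Suc.IH) simp_all
  qed
qed

text \<open>The real line carries the single chart \<open>id\<close> on \<open>UNIV\<close>, so the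
  preimage and the outer coordinate map disappear.\<close>

lemma smooth_fun_iff:
  "smooth_fun A f \<longleftrightarrow> continuous_on UNIV f \<and>
     (\<forall>(U, \<phi>)\<in>A. smooth_on (\<phi> ` U) (\<lambda>x. f (inv_into U \<phi> x)))"
  by (simp add: smooth_fun_def smooth_map_def o_def)

lemma smooth_fun_const: "smooth_fun A (\<lambda>_. c)"
  by (auto simp: smooth_fun_iff smooth_on_def C_k_on_const)

lemma smooth_fun_add:
  assumes "smooth_atlas A" "smooth_fun A f" "smooth_fun A h"
  shows "smooth_fun A (f + h)"
  unfolding smooth_fun_iff
proof (intro conjI ballI, goal_cases)
  case 1
  then show ?case
    using assms(2,3) by (auto simp: smooth_fun_iff plus_fun_def intro!: continuous_on_add)
next
  case (2 c)
  obtain U \<phi> where c: "c = (U, \<phi>)" by (cases c)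
  have "open (\<phi> ` U)" using assms(1) 2 unfolding smooth_atlas_def c by blast
  then show ?case
    using assms(2,3) 2 unfolding smooth_fun_iff smooth_on_def c
    by (auto simp: plus_fun_def intro!: C_k_on_add)
qed

lemma smooth_fun_mult:
  assumes "smooth_atlas A" "smooth_fun A f" "smooth_fun A h"
  shows "smooth_fun A (f * h)"
  unfolding smooth_fun_iff
proof (intro conjI ballI, goal_cases)
  case 1
  then show ?case
    using assms(2,3) by (auto simp: smooth_fun_iff times_fun_def intro!: continuous_on_mult)
next
  case (2 c)
  obtain U \<phi> where c: "c = (U, \<phi>)" by (cases c)
  have "open (\<phi> ` U)" using assms(1) 2 unfolding smooth_atlas_def c by blast
  then show ?case
    using assms(2,3) 2 unfolding smooth_fun_iff smooth_on_def c
    by (auto simp: times_fun_def intro!: C_k_on_mult)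
qed

lemma smooth_fun_cmult:
  assumes "smooth_atlas A" "smooth_fun A f"
  shows "smooth_fun A (\<lambda>p. c * f p)"
  using smooth_fun_mult[OF assms(1) smooth_fun_const assms(2), of c] by (simp add: times_fun_def)

lemma smooth_fun_diff:
  assumes "smooth_atlas A" "smooth_fun A f" "smooth_fun A h"
  shows "smooth_fun A (f - h)"
proof -
  have "f - h = f + (\<lambda>p. -1 * h p)" by (simp add: fun_eq_iff)
  then show ?thesis
    using smooth_fun_add[OF assms(1,2) smooth_fun_cmult[OF assms(1,3)]] by metis
qed

section \<open>Derivations and vector fields\<close>

lemma
  assumes "v \<in> tangent_space A p"
  shows tangent_add: "smooth_fun A f \<Longrightarrow> smooth_fun A h \<Longrightarrow> v (f + h) = v f + v h"
    and tangent_cmult: "smooth_fun A f \<Longrightarrow> v (\<lambda>q. c * f q) = c * v f"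
    and tangent_mult: "smooth_fun A f \<Longrightarrow> smooth_fun A h \<Longrightarrow> v (f * h) = v f * h p + f p * v h"
    and tangent_not_smooth: "\<not> smooth_fun A f \<Longrightarrow> v f = 0"
  using assms by (auto simp: tangent_space_def)

text \<open>Leibniz on 1 = 1 * 1 gives v(1) = 2 v(1), and homogeneity does the rest. It serves
  twice: for the constant inner products of left-invariant fields, and for functions that are not
  smooth, where \<open>app Z f\<close> is the constant 0.\<close>

lemma tangent_const:
  assumes "v \<in> tangent_space A p"
  shows "v (\<lambda>_. c) = 0"
proof -
  have "v (\<lambda>_. 1) = v ((\<lambda>_. 1) * (\<lambda>_. 1))" by (simp add: times_fun_def)
  also have "\<dots> = v (\<lambda>_. 1) + v (\<lambda>_. 1)"
    by (subst tangent_mult[OF assms smooth_fun_const smooth_fun_const]) simp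
  finally have "v (\<lambda>_. 1) = 0" by simp
  then show ?thesis using tangent_cmult[OF assms smooth_fun_const, of c 1] by simp
qed

lemma tangent_space_add:
  "v \<in> tangent_space A p \<Longrightarrow> w \<in> tangent_space A p \<Longrightarrow> v + w \<in> tangent_space A p"
  by (auto simp: tangent_space_def algebra_simps)

lemma tangent_space_tscale: "v \<in> tangent_space A p \<Longrightarrow> tscale c v \<in> tangent_space A p"
  by (auto simp: tangent_space_def tscale_def algebra_simps)

lemma vector_fields_tangent: "X \<in> vector_fields A \<Longrightarrow> X p \<in> tangent_space A p"
  and vector_fields_smooth: "X \<in> vector_fields A \<Longrightarrow> smooth_fun A f \<Longrightarrow> smooth_fun A (app X f)"
  by (auto simp: vector_fields_def)

lemma app_add: "app (X + Y) f = app X f + app Y f"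
  by (simp add: app_def fun_eq_iff)

lemma vscale_apply: "vscale h X p f = h p * X p f"
  by (simp add: vscale_def tscale_def)

lemma app_vscale: "app (vscale (\<lambda>_. c) X) f = (\<lambda>p. c * app X f p)"
  by (simp add: app_def vscale_apply)

lemma app_lie_bracket: "app (lie_bracket X Y) f = app X (app Y f) - app Y (app X f)"
  by (simp add: app_def lie_bracket_def fun_eq_iff)

lemma vector_fields_add:
  assumes "smooth_atlas A" "X \<in> vector_fields A" "Y \<in> vector_fields A"
  shows "X + Y \<in> vector_fields A"
  using assms by (simp add: vector_fields_def app_add smooth_fun_add tangent_space_add)

lemma vector_fields_vscale:
  assumes "smooth_atlas A" "X \<in> vector_fields A"
  shows "vscale (\<lambda>_. c) X \<in> vector_fields A"
  using assms by (simp add: vector_fields_def app_vscale smooth_fun_cmult)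
    (simp add: vscale_def tangent_space_tscale)

lemma diff_conv_vscale: "X - Y = X + vscale (\<lambda>_. -1) Y"
  by (simp add: fun_eq_iff vscale_apply)

text \<open>A composite of two fields is of second order, but the mixed terms X(f) Y(h) + Y(f) X(h)
  in its Leibniz expansion are symmetric in X and Y, so they cancel in the commutator.\<close>

lemma tangent_lie_bracket:
  assumes A: "smooth_atlas A" and X: "X \<in> vector_fields A" and Y: "Y \<in> vector_fields A"
  shows "lie_bracket X Y p \<in> tangent_space A p"
proof -
  note T = vector_fields_tangent[OF X] vector_fields_tangent[OF Y]
  note S = vector_fields_smooth[OF X] vector_fields_smooth[OF Y]
  have add: "app Z (f + h) = app Z f + app Z h"
    and cmult: "app Z (\<lambda>q. c * f q) = (\<lambda>q. c * app Z f q)"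
    and mult: "app Z (f * h) = app Z f * h + f * app Z h"
    if "Z \<in> vector_fields A" "smooth_fun A f" "smooth_fun A h" for Z f h c
    using that(2,3) tangent_add[OF vector_fields_tangent[OF that(1)]]
      tangent_cmult[OF vector_fields_tangent[OF that(1)]]
      tangent_mult[OF vector_fields_tangent[OF that(1)]]
    by (simp_all add: fun_eq_iff app_def)
  have "app Z f = (\<lambda>_. 0)" if "Z \<in> vector_fields A" "\<not> smooth_fun A f" for Z f
    using tangent_not_smooth[OF vector_fields_tangent[OF that(1)] that(2)]
    by (simp add: fun_eq_iff app_def)
  then have "lie_bracket X Y p f = 0" if "\<not> smooth_fun A f" for f
    using X Y that tangent_const[OF T(1)] tangent_const[OF T(2)] by (simp add: lie_bracket_def)
  moreover have "lie_bracket X Y p (f + h) = lie_bracket X Y p f + lie_bracket X Y p h"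
    if "smooth_fun A f" "smooth_fun A h" for f h
    using that by (simp add: lie_bracket_def add X Y S tangent_add[OF T(1)] tangent_add[OF T(2)])
  moreover have "lie_bracket X Y p (\<lambda>q. c * f q) = c * lie_bracket X Y p f"
    if "smooth_fun A f" for c f
    using that by (simp add: lie_bracket_def cmult[OF _ that that] X Y S
        tangent_cmult[OF T(1)] tangent_cmult[OF T(2)] algebra_simps)
  moreover have "lie_bracket X Y p (f * h) = lie_bracket X Y p f * h p + f p * lie_bracket X Y p h"
    if "smooth_fun A f" "smooth_fun A h" for f h
    using that
    \<comment> \<open>First both layers of Leibniz are expanded; unfolding \<open>app\<close>
      afterwards identifies the mixed terms, which then cancel.\<close>
    by (simp add: lie_bracket_def mult X Y S smooth_fun_mult[OF A]
        tangent_add[OF T(1)] tangent_add[OF T(2)] tangent_mult[OF T(1)] tangent_mult[OF T(2)])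
      (simp add: app_def algebra_simps)
  ultimately show ?thesis unfolding tangent_space_def by blast
qed

lemma vector_fields_lie_bracket:
  assumes "smooth_atlas A" "X \<in> vector_fields A" "Y \<in> vector_fields A"
  shows "lie_bracket X Y \<in> vector_fields A"
  using assms tangent_lie_bracket[OF assms]
  unfolding vector_fields_def by (auto simp: app_lie_bracket intro!: smooth_fun_diff)

text \<open>Equality of fields is equality of HOL functions, so arguments that are not smooth must
  be treated as well; there every bracket is 0.\<close>

lemma lie_bracket_add_left:
  assumes "X \<in> vector_fields A" "X' \<in> vector_fields A" "Y \<in> vector_fields A"
  shows "lie_bracket (X + X') Y = lie_bracket X Y + lie_bracket X' Y"
proof -
  have "lie_bracket (X + X') Y p f = lie_bracket X Y p f + lie_bracket X' Y p f" for p f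
  proof (cases "smooth_fun A f")
    case True
    then show ?thesis
      using assms by (simp add: lie_bracket_def app_add vector_fields_smooth
          tangent_add[OF vector_fields_tangent])
  next
    case False
    then have "app Z f = (\<lambda>_. 0)" if "Z \<in> vector_fields A" for Z
      using tangent_not_smooth[OF vector_fields_tangent[OF that] False]
      by (simp add: fun_eq_iff app_def)
    \<comment> \<open>Closure of \<open>vector_fields A\<close> under sums relies on
      \<open>smooth_atlas A\<close>, which is not assumed here; the sum is therefore split by
      \<open>app_add\<close>.\<close>
    moreover have "app (X + X') f = (\<lambda>_. 0)"
      unfolding app_add using calculation assms by (simp add: plus_fun_def)
    ultimately show ?thesis
      using assms by (simp add: lie_bracket_def tangent_const[OF vector_fields_tangent])
  qed
  then show ?thesis by (simp add: fun_eq_iff)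
qed

lemma lie_bracket_vscale_left:
  assumes "X \<in> vector_fields A" "Y \<in> vector_fields A"
  shows "lie_bracket (vscale (\<lambda>_. c) X) Y = vscale (\<lambda>_. c) (lie_bracket X Y)"
proof -
  have "lie_bracket (vscale (\<lambda>_. c) X) Y p f = c * lie_bracket X Y p f" for p f
  proof (cases "smooth_fun A f")
    case True
    then have "Y p (\<lambda>q. c * app X f q) = c * Y p (app X f)"
      using assms by (intro tangent_cmult[OF vector_fields_tangent] vector_fields_smooth)
    then show ?thesis
      by (simp add: lie_bracket_def app_vscale vscale_apply algebra_simps)
  next
    case False
    then have "app X f = (\<lambda>_. 0)"
      using tangent_not_smooth[OF vector_fields_tangent[OF assms(1)] False]
      by (simp add: fun_eq_iff app_def)
    then show ?thesis
      using tangent_const[OF vector_fields_tangent[OF assms(2)]]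
      by (simp add: lie_bracket_def app_vscale vscale_apply)
  qed
  then show ?thesis by (simp add: fun_eq_iff vscale_apply)
qed

lemma lie_bracket_swap: "lie_bracket Y X = - lie_bracket X Y"
  by (simp add: lie_bracket_def fun_eq_iff)

section \<open>Left-invariant fields\<close>

lemma lie_algebra_vector_fields: "X \<in> lie_algebra mul minv A \<Longrightarrow> X \<in> vector_fields A"
  by (simp add: lie_algebra_def)

lemma lie_algebra_add:
  assumes "smooth_atlas A" "X \<in> lie_algebra mul minv A" "Y \<in> lie_algebra mul minv A"
  shows "X + Y \<in> lie_algebra mul minv A"
proof -
  have "left_translate mul minv A a (X + Y) =
      left_translate mul minv A a X + left_translate mul minv A a Y" for a
    by (simp add: left_translate_def tangent_map_def fun_eq_iff)
  then show ?thesis using assms by (simp add: lie_algebra_def vector_fields_add)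
qed

lemma lie_algebra_vscale:
  assumes "smooth_atlas A" "X \<in> lie_algebra mul minv A"
  shows "vscale (\<lambda>_. c) X \<in> lie_algebra mul minv A"
proof -
  have "left_translate mul minv A a (vscale (\<lambda>_. c) X) =
      vscale (\<lambda>_. c) (left_translate mul minv A a X)" for a
    by (simp add: left_translate_def tangent_map_def vscale_apply fun_eq_iff)
  then show ?thesis using assms by (simp add: lie_algebra_def vector_fields_vscale)
qed

lemma lie_algebra_diff:
  assumes "smooth_atlas A" "X \<in> lie_algebra mul minv A" "Y \<in> lie_algebra mul minv A"
  shows "X - Y \<in> lie_algebra mul minv A"
  unfolding diff_conv_vscale using assms by (intro lie_algebra_add lie_algebra_vscale)

text \<open>Invariance is evaluated at the translated point, where the inverse in
  \<open>left_translate\<close> cancels. This says that X is related to itself by each left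
  translation.\<close>

lemma lie_algebra_mul:
  assumes "group mul e minv" "X \<in> lie_algebra mul minv A"
  shows "X (mul a q) = tangent_map A (mul a) (X q)"
proof -
  interpret group mul e minv by fact
  have "mul (minv a) (mul a q) = q" by (simp flip: assoc)
  moreover have "X (mul a q) = left_translate mul minv A a X (mul a q)"
    using assms(2) by (simp add: lie_algebra_def)
  ultimately show ?thesis by (simp add: left_translate_def)
qed

text \<open>A field related to itself by a left translation commutes, as an operator on smooth
  functions, with composition by that translation. The commutator of two such operators inherits
  this.\<close>

lemma lie_algebra_lie_bracket:
  assumes grp: "group mul e minv" and A: "smooth_atlas A"
    and XY: "X \<in> lie_algebra mul minv A" "Y \<in> lie_algebra mul minv A"
  shows "lie_bracket X Y \<in> lie_algebra mul minv A"
proof -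
  interpret group mul e minv by fact
  note vf = XY[THEN lie_algebra_vector_fields]
  have inverse_right: "mul a (mul (minv a) p) = p" for a p
    by (simp flip: assoc)
  have "left_translate mul minv A a (lie_bracket X Y) p f = lie_bracket X Y p f" for a p f
  proof (cases "smooth_fun A f")
    case False
    then show ?thesis
      using tangent_not_smooth[OF tangent_lie_bracket[OF A vf] False]
      by (simp add: left_translate_def tangent_map_def)
  next
    case True
    \<comment> \<open>This is applied with \<open>h\<close> equal to \<open>app X f\<close> or
      \<open>app Y f\<close>, and so handles the outer field of each composite; the next fact
      handles the inner one.\<close>
    have pull: "V (mul (minv a) p) (h \<circ> mul a) = V p h"
      if "V \<in> lie_algebra mul minv A" "smooth_fun A h" for V h p
      using lie_algebra_mul[OF grp that(1), of a "mul (minv a) p"] that(2)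
      by (simp add: inverse_right tangent_map_def)
    have "app V (f \<circ> mul a) = app V f \<circ> mul a" if "V \<in> lie_algebra mul minv A" for V
      using lie_algebra_mul[OF grp that, of a] True by (simp add: fun_eq_iff app_def tangent_map_def)
    then show ?thesis
      using XY True vf
      by (simp add: left_translate_def tangent_map_def lie_bracket_def pull vector_fields_smooth)
  qed
  then show ?thesis using vector_fields_lie_bracket[OF A vf] by (simp add: lie_algebra_def fun_eq_iff)
qed

text \<open>Left translation by \<open>q\<close> sends \<open>e\<close> to \<open>q\<close>, carries
  \<open>X e\<close> to \<open>X q\<close> and \<open>Y e\<close> to \<open>Y q\<close>, and
  preserves \<open>g\<close>.\<close>

lemma left_invariant_inner_const:
  assumes "group mul e minv" "left_invariant_metric mul A g"
    and X: "X \<in> lie_algebra mul minv A" and Y: "Y \<in> lie_algebra mul minv A"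
  shows "g q (X q) (Y q) = g e (X e) (Y e)"
proof -
  interpret group mul e minv by fact
  have "X e \<in> tangent_space A e" "Y e \<in> tangent_space A e"
    using X Y lie_algebra_vector_fields vector_fields_tangent by blast+
  then have "g (mul q e) (X (mul q e)) (Y (mul q e)) = g e (X e) (Y e)"
    using assms(2) unfolding left_invariant_metric_def
      lie_algebra_mul[OF assms(1) X] lie_algebra_mul[OF assms(1) Y] by blast
  then show ?thesis by simp
qed

text \<open>The term that differentiates g(Y, Z) vanishes because this function is constant.\<close>

lemma cov_deriv_metric_left_invariant:
  assumes "group mul e minv" "left_invariant_metric mul A g"
    and "X \<in> vector_fields A" "Y \<in> lie_algebra mul minv A" "Z \<in> lie_algebra mul minv A"
  shows "cov_deriv_metric D g X Y Z e = - lie_inner e g (D X Y) Z - lie_inner e g Y (D X Z)"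
proof -
  have "(\<lambda>q. g q (Y q) (Z q)) = (\<lambda>_. g e (Y e) (Z e))"
    using left_invariant_inner_const[OF assms(1,2,4,5)] by blast
  then show ?thesis
    using tangent_const[OF vector_fields_tangent[OF assms(3)]]
    by (simp add: cov_deriv_metric_def lie_inner_def)
qed

section \<open>Symmetry and linearity of the inner product at the identity\<close>

lemma
  assumes "riemannian_metric A g"
    and "X \<in> vector_fields A" "Y \<in> vector_fields A" "Z \<in> vector_fields A"
  shows lie_inner_add_left: "lie_inner e g (X + Y) Z = lie_inner e g X Z + lie_inner e g Y Z"
    and lie_inner_vscale_left: "lie_inner e g (vscale (\<lambda>_. c) X) Z = c * lie_inner e g X Z"
    and lie_inner_commute: "lie_inner e g X Y = lie_inner e g Y X"
proof -
  have T: "X e \<in> tangent_space A e" "Y e \<in> tangent_space A e" "Z e \<in> tangent_space A e"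
    using assms(2-4) by (simp_all add: vector_fields_tangent)
  have "g e (X e + Y e) (Z e) = g e (X e) (Z e) + g e (Y e) (Z e)"
    and "g e (tscale c (X e)) (Z e) = c * g e (X e) (Z e)"
    and "g e (X e) (Y e) = g e (Y e) (X e)"
    using assms(1) T unfolding riemannian_metric_def by blast+
  then show "lie_inner e g (X + Y) Z = lie_inner e g X Z + lie_inner e g Y Z"
    and "lie_inner e g (vscale (\<lambda>_. c) X) Z = c * lie_inner e g X Z"
    and "lie_inner e g X Y = lie_inner e g Y X"
    by (simp_all add: lie_inner_def vscale_def)
qed

lemma lie_inner_diff_left:
  assumes "smooth_atlas A" "riemannian_metric A g"
    and "X \<in> vector_fields A" "Y \<in> vector_fields A" "Z \<in> vector_fields A"
  shows "lie_inner e g (X - Y) Z = lie_inner e g X Z - lie_inner e g Y Z"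
  \<comment> \<open>The sum and scaling rules share one list of premises; in the scaling rule
    \<open>assms(4)\<close> fills both of the first two field slots with \<open>Y\<close>.\<close>
  using lie_inner_add_left[OF assms(2,3) vector_fields_vscale[OF assms(1,4), of "-1"] assms(5)]
    lie_inner_vscale_left[OF assms(2,4,4,5), of _ "-1"]
  by (simp add: diff_conv_vscale)

section \<open>The symmetric part of a left-invariant connection\<close>

theorem proposition3p0p1:
  fixes mul :: "'a::{t2_space,second_countable_topology} \<Rightarrow> 'a \<Rightarrow> 'a" and e :: 'a and minv :: "'a \<Rightarrow> 'a"
    and A :: "('a, 'e::real_normed_vector) atlas"
    and g :: "'a metric_tensor"
    and U :: "'a vfield \<Rightarrow> 'a vfield \<Rightarrow> 'a vfield"
    and D :: "'a connection"
  defines "\<gg> \<equiv> lie_algebra mul minv A"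
  assumes "lie_group mul e minv A" and "connected (UNIV :: 'a set)"
    and "riemannian_metric A g" and "left_invariant_metric mul A g"
    and "symmetric_bilinear_map \<gg> U"
    and "\<And>X Y Z. X \<in> \<gg> \<Longrightarrow> Y \<in> \<gg> \<Longrightarrow> Z \<in> \<gg> \<Longrightarrow>
      2 * lie_inner e g (U X Y) Z =
        lie_inner e g (lie_bracket Z X) Y + lie_inner e g X (lie_bracket Z Y)"
    and "affine_connection A D" and "left_invariant_connection mul minv A D"
    and "compatible A g D"
  shows "\<exists>\<nu>. symmetric_bilinear_map \<gg> \<nu> \<and>
    (\<forall>X\<in>\<gg>. \<forall>Y\<in>\<gg>. D X Y = \<nu> X Y + vscale (\<lambda>_. 1/2) (lie_bracket X Y)) \<and>
    (\<forall>X\<in>\<gg>. \<forall>Y\<in>\<gg>. \<forall>Z\<in>\<gg>.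
      lie_inner e g (U Y Z - \<nu> Y Z) X = lie_inner e g Y (U X Z - \<nu> X Z))"
proof -
  note L_def = assms(1)
  let ?in = "lie_inner e g"
  let ?half = "\<lambda>B. vscale (\<lambda>_. 1/2) B"
  define \<nu> where "\<nu> = (\<lambda>X Y. D X Y - ?half (lie_bracket X Y))"
  have grp: "group mul e minv" and A: "smooth_atlas A"
    using assms(2) by (auto simp: lie_group_def)
  have tf: "torsion_free A D" using assms(10) by (simp add: compatible_def)
  have vf: "X \<in> vector_fields A" if "X \<in> \<gg>" for X
    using that lie_algebra_vector_fields unfolding L_def by blast
  have br: "lie_bracket X Y \<in> \<gg>" if "X \<in> \<gg>" "Y \<in> \<gg>" for X Y
    using that lie_algebra_lie_bracket[OF grp A] unfolding L_def by blast
  have hbr: "?half (lie_bracket X Y) \<in> \<gg>" if "X \<in> \<gg>" "Y \<in> \<gg>" for X Y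
    using br[OF that] lie_algebra_vscale[OF A] unfolding L_def by blast
  have Dg: "D X Y \<in> \<gg>" if "X \<in> \<gg>" "Y \<in> \<gg>" for X Y
  proof -
    \<comment> \<open>Invariance of \<open>D\<close> moves the translation onto \<open>X\<close> and
      \<open>Y\<close>, which it fixes.\<close>
    have "left_translate mul minv A a (D X Y) = D X Y" for a
      using assms(9) that vf[OF that(1)] vf[OF that(2)]
      by (simp add: left_invariant_connection_def L_def lie_algebra_def)
    moreover have "D X Y \<in> vector_fields A"
      using assms(8) vf[OF that(1)] vf[OF that(2)] by (simp add: affine_connection_def)
    ultimately show ?thesis by (simp add: L_def lie_algebra_def)
  qed
  have \<nu>g: "\<nu> X Y \<in> \<gg>" if "X \<in> \<gg>" "Y \<in> \<gg>" for X Y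
    using lie_algebra_diff[OF A] Dg[OF that] hbr[OF that] unfolding \<nu>_def L_def by blast
  have Ug: "U X Y \<in> \<gg>" if "X \<in> \<gg>" "Y \<in> \<gg>" for X Y
    using assms(6) that by (simp add: symmetric_bilinear_map_def)
  have D_eq: "D X Y = \<nu> X Y + ?half (lie_bracket X Y)" for X Y
    by (simp add: \<nu>_def fun_eq_iff)
  have \<nu>_sym: "\<nu> X Y = \<nu> Y X" if "X \<in> \<gg>" "Y \<in> \<gg>" for X Y
  proof -
    \<comment> \<open>Vanishing torsion makes the antisymmetric part of \<open>D\<close> exactly
      half the bracket, so removing that half leaves a symmetric map.\<close>
    have "D X Y p f - D Y X p f = lie_bracket X Y p f" for p f
      using tf vf[OF that(1)] vf[OF that(2)] unfolding torsion_free_def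
      by (metis fun_diff_def)
    then show ?thesis
      by (simp add: \<nu>_def fun_eq_iff vscale_apply lie_bracket_swap[of Y X] field_simps)
  qed
  have \<nu>_add: "\<nu> (X + X') Y = \<nu> X Y + \<nu> X' Y" if "X \<in> \<gg>" "X' \<in> \<gg>" "Y \<in> \<gg>" for X X' Y
  proof -
    have "D (X + X') Y = D X Y + D X' Y"
      using assms(8) that[THEN vf] by (simp add: affine_connection_def)
    then show ?thesis
      unfolding \<nu>_def lie_bracket_add_left[OF that[THEN vf]]
      by (simp add: fun_eq_iff vscale_apply algebra_simps)
  qed
  have \<nu>_scale: "\<nu> (vscale (\<lambda>_. c) X) Y = vscale (\<lambda>_. c) (\<nu> X Y)" if "X \<in> \<gg>" "Y \<in> \<gg>" for c X Y
  proof -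
    \<comment> \<open>Real homogeneity is linearity over smooth functions, applied to a constant
      function.\<close>
    have "D (vscale (\<lambda>_. c) X) Y = vscale (\<lambda>_. c) (D X Y)"
      using assms(8) that[THEN vf] smooth_fun_const[of A c] unfolding affine_connection_def by blast
    then show ?thesis
      unfolding \<nu>_def lie_bracket_vscale_left[OF that[THEN vf]]
      by (simp add: fun_eq_iff vscale_apply algebra_simps)
  qed
  have inner_commute: "?in X Y = ?in Y X" if "X \<in> \<gg>" "Y \<in> \<gg>" for X Y
    using lie_inner_commute[OF assms(4)] that[THEN vf] by blast
  have inner_D: "?in (D X Y) Z = ?in (\<nu> X Y) Z + ?in (lie_bracket X Y) Z / 2"
    if "X \<in> \<gg>" "Y \<in> \<gg>" "Z \<in> \<gg>" for X Y Z
    using lie_inner_add_left[OF assms(4) \<nu>g[THEN vf] hbr[THEN vf] vf]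
      lie_inner_vscale_left[OF assms(4) br[THEN vf] br[THEN vf] vf] that
    by (simp add: D_eq)
  have inner_swap: "?in (lie_bracket Y X) Z = - ?in (lie_bracket X Y) Z"
    if "X \<in> \<gg>" "Y \<in> \<gg>" "Z \<in> \<gg>" for X Y Z
  proof -
    have "lie_bracket Y X = vscale (\<lambda>_. -1) (lie_bracket X Y)"
      by (simp add: lie_bracket_swap[of Y X] fun_eq_iff vscale_apply)
    then show ?thesis
      using lie_inner_vscale_left[OF assms(4) br[THEN vf] br[THEN vf] vf] that by simp
  qed
  have "?in (U Y Z - \<nu> Y Z) X = ?in Y (U X Z - \<nu> X Z)"
    if X: "X \<in> \<gg>" and Y: "Y \<in> \<gg>" and Z: "Z \<in> \<gg>" for X Y Z
  proof -
    have cov: "cov_deriv_metric D g V W Z e = - ?in (D V W) Z - ?in (D V Z) W"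
      if "V \<in> \<gg>" "W \<in> \<gg>" for V W
      using cov_deriv_metric_left_invariant[OF grp assms(5) vf[OF that(1)]]
        that Z inner_commute[OF that(2) Dg[OF that(1) Z]] unfolding L_def by simp
    \<comment> \<open>Of the total symmetry of \<nabla>g, this is the transposition that mixes the
      direction of differentiation with an argument of g.\<close>
    have "cov_deriv_metric D g X Y Z e = cov_deriv_metric D g Y X Z e"
      using assms(10) X[THEN vf] Y[THEN vf] Z[THEN vf] unfolding compatible_def by metis
    then have "?in (D X Y) Z + ?in (D X Z) Y = ?in (D Y X) Z + ?in (D Y Z) X"
      using cov X Y by simp
    \<comment> \<open>After splitting \<open>D\<close>, the terms \<nu>(X, Y) and \<nu>(Y, X)
      cancel, while the half brackets of X and Y, of opposite sign on the two sides, add up to a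
      full one.\<close>
    then have "?in (lie_bracket X Y) Z + ?in (lie_bracket X Z) Y / 2 - ?in (lie_bracket Y Z) X / 2
        = ?in (\<nu> Y Z) X - ?in (\<nu> X Z) Y"
      using X Y Z by (simp add: inner_D \<nu>_sym[OF Y X] inner_swap[OF X Y Z])
    \<comment> \<open>The difference of this equation and the next is twice the bracket expression
      just found, so U and \<nu> have the same antisymmetric defect.\<close>
    moreover have "2 * ?in (U Y Z) X = ?in (lie_bracket X Y) Z + ?in (lie_bracket X Z) Y"
      using assms(7)[OF Y Z X] inner_commute[OF Y br[OF X Z]] by simp
    moreover have "2 * ?in (U X Z) Y = - ?in (lie_bracket X Y) Z + ?in (lie_bracket Y Z) X"
      using assms(7)[OF X Z Y] inner_commute[OF X br[OF Y Z]] inner_swap[OF X Y Z] by simp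
    ultimately have "?in (U Y Z) X - ?in (\<nu> Y Z) X = ?in (U X Z) Y - ?in (\<nu> X Z) Y"
      by (simp add: field_simps)
    \<comment> \<open>Membership in the Lie algebra allows the symmetry of the inner product to move
      this difference into the second argument.\<close>
    moreover have "U X Z - \<nu> X Z \<in> \<gg>"
      using lie_algebra_diff[OF A] Ug[OF X Z] \<nu>g[OF X Z] unfolding L_def by blast
    ultimately show ?thesis
      using X Y Z by (simp add: inner_commute[OF Y] lie_inner_diff_left[OF A assms(4)] Ug \<nu>g vf)
  qed
  moreover have "symmetric_bilinear_map \<gg> \<nu>"
    unfolding symmetric_bilinear_map_def using \<nu>g \<nu>_sym \<nu>_add \<nu>_scale by blast
  ultimately show ?thesis using D_eq by blast
qed

end
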